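(* Let $a,b$ be integers with $a^4\neq 1024b$ and let $g=\gcd(32,8a,a^2)$. If $(x,y)\in\mathbb{Z}^2$ satisfies $x^4-4y^2+axy+b=0$, then there exists an integer divisor $d_1$ of $\frac{a^4-1024b}{g^2}$ such that $$64x^2=d_1g+\frac{a^4-1024b}{d_1g}-2a^2.$$ *)

theory Defs imports Complex_Main begin

(* The integer division by g^2 in the statement is exact. *)
lemma gcd_square_dvd:
  fixes a b :: int
  shows "(gcd 32 (gcd (8 * a) (a ^ 2))) ^ 2 dvd a ^ 4 - 1024 * b"
proof -
  let ?g = "gcd 32 (gcd (8 * a) (a ^ 2))"
  have g1: "?g dvd 32" and g2: "?g dvd a ^ 2"
    by (rule gcd_dvd1, rule dvd_trans[OF gcd_dvd2 gcd_dvd2])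
  have "?g ^ 2 dvd (32::int) ^ 2" using g1 by (rule dvd_power_same)
  then have "?g ^ 2 dvd 1024 * b" by (simp add: dvd_mult2)
  moreover have "?g ^ 2 dvd (a ^ 2) ^ 2" using g2 by (rule dvd_power_same)
  then have "?g ^ 2 dvd a ^ 4" by (simp flip: power_mult)
  ultimately show ?thesis by (rule dvd_diff[rotated])
qed

end

theory Submission imports Defs begin

text \<open>
  Put \<open>w = 8y - ax\<close>. Completing squares in \<open>y\<close> and then in \<open>x\<^sup>2\<close> turns the equation into
  \<open>(32x\<^sup>2 + a\<^sup>2)\<^sup>2 - (8w)\<^sup>2 = a\<^sup>4 - 1024b\<close>. Both factors \<open>32x\<^sup>2 + a\<^sup>2 \<plusminus> 8w\<close> are divisible by \<open>g\<close>
  and their sum is \<open>64x\<^sup>2 + 2a\<^sup>2\<close>, so \<open>d\<^sub>1\<close> is the first factor divided by \<open>g\<close>.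
\<close>

theorem theorem4p7:
  fixes a b g x y :: int
  assumes "a ^ 4 \<noteq> 1024 * b"
    and "g = gcd 32 (gcd (8 * a) (a ^ 2))"
    and "x ^ 4 - 4 * y ^ 2 + a * x * y + b = 0"
  shows "\<exists>d\<^sub>1 :: int. d\<^sub>1 dvd (a ^ 4 - 1024 * b) div g ^ 2 \<and>
    64 * real_of_int x ^ 2 =
      real_of_int d\<^sub>1 * real_of_int g
        + real_of_int (a ^ 4 - 1024 * b) / (real_of_int d\<^sub>1 * real_of_int g)
        - 2 * real_of_int a ^ 2"
proof -
  \<comment> \<open>The factors with \<open>+ 8w\<close> and \<open>- 8w\<close>, grouped so that
    each summand is visibly a multiple of \<open>32\<close>, \<open>8 * a\<close> or
    \<open>a ^ 2\<close>, hence of \<open>g\<close>.\<close>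
  define P where "P = 32 * (x ^ 2 + 2 * y) - 8 * a * x + a ^ 2"
  define Q where "Q = 32 * (x ^ 2 - 2 * y) + 8 * a * x + a ^ 2"
  \<comment> \<open>Eliminating \<open>b\<close> turns the factorisation into a polynomial identity
    in \<open>a\<close>, \<open>x\<close>, \<open>y\<close>.\<close>
  have b: "b = 4 * y ^ 2 - a * x * y - x ^ 4"
    using assms(3) by simp
  have PQ: "P * Q = a ^ 4 - 1024 * b"
    unfolding P_def Q_def b by algebra
  have "g dvd 32" "g dvd 8 * a" "g dvd a ^ 2"
    unfolding assms(2) by (meson dvd_trans gcd_dvd1 gcd_dvd2)+
  then have "g dvd P" "g dvd Q"
    unfolding P_def Q_def by (blast intro: dvd_add dvd_diff dvd_mult2)+
  then obtain p q where p: "P = g * p" and q: "Q = g * q"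
    by (elim dvdE)
  \<comment> \<open>\<open>P * Q\<close> is nonzero by hypothesis, and \<open>g\<close> divides
    \<open>P\<close>. So the integer division by \<open>g ^ 2\<close> and the real division by
    \<open>p * g = P\<close> both cancel.\<close>
  have nz: "P \<noteq> 0" "g \<noteq> 0"
    using assms(1) PQ p by auto
  have "(a ^ 4 - 1024 * b) div g ^ 2 = p * q"
    unfolding PQ[symmetric] p q using nz by (simp add: power2_eq_square)
  moreover have "real_of_int (a ^ 4 - 1024 * b) / (real_of_int p * real_of_int g) = real_of_int Q"
    unfolding PQ[symmetric] p using nz by (simp add: p)
  \<comment> \<open>In \<open>P + Q\<close> the terms in \<open>y\<close> and \<open>a * x\<close>
    cancel.\<close>
  moreover have "64 * x ^ 2 = p * g + Q - 2 * a ^ 2"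
    using p by (simp add: P_def Q_def mult.commute)
  then have "64 * real_of_int x ^ 2 = real_of_int p * real_of_int g + real_of_int Q - 2 * real_of_int a ^ 2"
    by (metis of_int_add of_int_diff of_int_mult of_int_numeral of_int_power)
  ultimately show ?thesis
    by (intro exI[of _ p]) simp
qed

end
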